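(* Let $G$ be a regular connected graph with valency $k \geq 2$ and $n$ vertices, let $A$ be its adjacency matrix, and let $U = U(G)$ be the transition matrix of the discrete-time quantum walk on $G$. Then $S^+(U(G)^2)$ has eigenvalues as follows: (i) $k^2 - 2k + 2$ with multiplicity $1$; (ii) $\dfrac{\lambda^2 - 2k + 4}{2} \pm \dfrac{\lambda\sqrt{\lambda^2 - 4(k-1)}}{2}$ as $\lambda$ ranges over the eigenvalues of $A$ (counted with multiplicity) with $\lambda \neq k$; and (iii) $2$ with multiplicity $n(k-2) + 1$.
   Context: Graphs are finite, undirected and simple. The arcs of $G$ are the ordered pairs $uv$ with $u$ adjacent to $v$ (each edge gives two arcs, so a $k$-regular graph on $n$ vertices has $nk$ arcs). The transition matrix $U = U(G)$ has rows and columns indexed by the arcs of $G$, with entries $$U_{wx,uv} = \begin{cases} \frac{2}{d(v)} & \text{if } v = w \text{ and } u \neq x,\\ \frac{2}{d(v)} - 1 & \text{if } v = w \text{ and } u = x,\\ 0 & \text{otherwise,}\end{cases}$$ where $d(v)$ is the degree of $v$. For a real matrix $M$, the positive support $S^+(M)$ is the $0/1$-matrix of the same size with $(S^+(M))_{i,j} = 1$ if $M_{i,j} > 0$ and $0$ otherwise. The eigenvalues listed are all $nk$ eigenvalues of $S^+(U(G)^2)$ over $\mathbb{C}$, counted with multiplicity; if values from different items coincide, their multiplicities are added. When $\lambda^2 < 4(k-1)$ the square root is a complex square root, and in (ii) both signs are taken.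
   Formalization: The valency is assumed to be k ≥ 3 instead of k ≥ 2: for k = 2 (cycles) U is a permutation matrix, so S^+(U^2) = U^2 has only eigenvalues of modulus 1 and the claimed eigenvalue 2 does not occur. *)

theory Defs
  imports
    "HOL-Computational_Algebra.Computational_Algebra"
    "Graph_Theory.Graph_Theory"
    "Jordan_Normal_Form.Char_Poly"
begin

text \<open>
  A finite simple undirected graph is a \<open>pair_graph\<close>: finite, loop-free, with a symmetric set
  \<open>parcs G\<close> of ordered pairs, which is then literally the set of arcs of the graph.
\<close>

definition regular_graph :: "'v pair_pre_digraph \<Rightarrow> nat \<Rightarrow> bool" where
  "regular_graph G k \<longleftrightarrow> (\<forall>v \<in> pverts G. out_degree (with_proj G) v = k)"

text \<open>
  Rows and columns of a \<open>mat\<close> are numbered, so a matrix indexed by a finite set is given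
  relative to an enumeration \<open>xs\<close> of that set without repetitions.
\<close>

definition enumerates :: "'i list \<Rightarrow> 'i set \<Rightarrow> bool" where
  "enumerates xs X \<longleftrightarrow> distinct xs \<and> set xs = X"

definition indexed_mat :: "'i list \<Rightarrow> ('i \<Rightarrow> 'i \<Rightarrow> 'a) \<Rightarrow> 'a mat" where
  "indexed_mat xs f = mat (length xs) (length xs) (\<lambda>(i, j). f (xs ! i) (xs ! j))"

definition adjacency_matrix :: "'v pair_pre_digraph \<Rightarrow> 'v list \<Rightarrow> real mat" where
  "adjacency_matrix G vs = indexed_mat vs (\<lambda>u v. if (u, v) \<in> parcs G then 1 else 0)"

fun transition_entry :: "'v pair_pre_digraph \<Rightarrow> 'v \<times> 'v \<Rightarrow> 'v \<times> 'v \<Rightarrow> real" where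
  "transition_entry G (w, x) (u, v) =
     (if v = w \<and> u \<noteq> x then 2 / real (out_degree (with_proj G) v)
      else if v = w \<and> u = x then 2 / real (out_degree (with_proj G) v) - 1
      else 0)"

definition transition_matrix :: "'v pair_pre_digraph \<Rightarrow> ('v \<times> 'v) list \<Rightarrow> real mat" where
  "transition_matrix G es = indexed_mat es (transition_entry G)"

definition positive_support :: "real mat \<Rightarrow> real mat" where
  "positive_support M = map_mat (\<lambda>a. if a > 0 then 1 else 0) M"

text \<open>All complex eigenvalues of a square real matrix, with algebraic multiplicity.\<close>

definition complex_eigenvalues :: "real mat \<Rightarrow> complex multiset" where
  "complex_eigenvalues M = proots (char_poly (map_mat complex_of_real M))"

text \<open>
  For \<open>k = 2\<close> the backtracking entry \<open>2 / k - 1\<close> of the transition matrix vanishes, so the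
  positive support of its square is a permutation matrix and has no eigenvalue \<open>k\<^sup>2 - 2 * k + 2 = 2\<close>.
  For this reason the eigenvalue description of the positive support of the square
  is only stated for valency \<open>k \<ge> 3\<close>.
\<close>

end

theory Submission
  imports Defs
begin

text \<open>
  The positive support of \<open>U\<^sup>2\<close> is \<open>B\<^sup>2 + 1\<close>, where \<open>B\<close> is the nonbacktracking matrix on arcs.
  As in the Ihara--Bass formula, \<open>det (x\<^sup>2 - B\<^sup>2) = det (x - B) * det (x + B)\<close> is expressed, up to a power of
  \<open>t = x\<^sup>2 - 1\<close>, through \<open>det (t + k - x * A) * det (t + k + x * A)\<close>, that is, through the product of
  \<open>(t + k)\<^sup>2 - (t + 1) * l\<^sup>2\<close> over the eigenvalues \<open>l\<close> of \<open>A\<close>; this factor is quadratic in \<open>t\<close>, with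
  the two roots listed in the theorem (shifted by 2). The eigenvalue \<open>l = k\<close> contributes
  \<open>k\<^sup>2 - 2 * k + 2\<close> and \<open>2\<close>; it is simple because \<open>det (x - A) * (x - k + n) = (x - k) * det (x - A + 1 1\<^sup>T)\<close>
  and, by connectedness, \<open>k\<close> is not an eigenvalue of \<open>A - 1 1\<^sup>T\<close>.
\<close>

section \<open>Matrices indexed by lists of labels\<close>

text \<open>Rows and columns get separate label lists because the arc-vertex incidence matrices of
  the Ihara--Bass argument are not square.\<close>

definition rect_mat :: "'i list \<Rightarrow> 'j list \<Rightarrow> ('i \<Rightarrow> 'j \<Rightarrow> 'a) \<Rightarrow> 'a mat" where
  "rect_mat xs ys f = mat (length xs) (length ys) (\<lambda>(i, j). f (xs ! i) (ys ! j))"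

lemma indexed_mat_eq_rect_mat: "indexed_mat xs f = rect_mat xs xs f"
  by (simp add: indexed_mat_def rect_mat_def)

lemma rect_mat_carrier [simp]: "rect_mat xs ys f \<in> carrier_mat (length xs) (length ys)"
  by (simp add: rect_mat_def)

lemma indexed_mat_carrier [simp]: "indexed_mat xs f \<in> carrier_mat (length xs) (length xs)"
  by (simp add: indexed_mat_def)

lemma dim_indexed_mat [simp]:
  "dim_row (indexed_mat xs f) = length xs" "dim_col (indexed_mat xs f) = length xs"
  by (simp_all add: indexed_mat_def)

lemma rect_mat_cong:
  assumes "\<And>x y. x \<in> set xs \<Longrightarrow> y \<in> set ys \<Longrightarrow> f x y = g x y"
  shows "rect_mat xs ys f = rect_mat xs ys g"
  using assms by (intro eq_matI) (auto simp: rect_mat_def)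

lemma indexed_mat_cong:
  assumes "\<And>x y. x \<in> set xs \<Longrightarrow> y \<in> set xs \<Longrightarrow> f x y = g x y"
  shows "indexed_mat xs f = indexed_mat xs g"
  unfolding indexed_mat_eq_rect_mat using assms by (rule rect_mat_cong)

lemma sum_nth_distinct:
  assumes "distinct xs"
  shows "(\<Sum>i = 0..<length xs. f (xs ! i)) = sum f (set xs)"
  using sum.reindex_bij_betw[OF bij_betw_nth[OF assms refl refl], of f] atLeast0LessThan by simp

lemma rect_mat_mult:
  assumes "distinct ys"
  shows "rect_mat xs ys f * rect_mat ys zs g
    = rect_mat xs zs (\<lambda>x z. \<Sum>y\<in>set ys. f x y * g y z)"
  by (intro eq_matI)
    (auto simp: rect_mat_def scalar_prod_def simp flip: sum_nth_distinct[OF assms])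

lemma indexed_mat_mult:
  assumes "distinct xs"
  shows "indexed_mat xs f * indexed_mat xs g
    = indexed_mat xs (\<lambda>x z. \<Sum>y\<in>set xs. f x y * g y z)"
  unfolding indexed_mat_eq_rect_mat by (rule rect_mat_mult[OF assms])

section \<open>Determinants of labelled matrices and Sylvester's identity\<close>

lemma det_indexed_mat_mult:
  fixes f g :: "'i \<Rightarrow> 'i \<Rightarrow> 'a :: idom"
  assumes "distinct xs"
  shows "det (indexed_mat xs f) * det (indexed_mat xs g)
    = det (indexed_mat xs (\<lambda>x z. \<Sum>y\<in>set xs. f x y * g y z))"
  by (simp add: det_mult[OF indexed_mat_carrier indexed_mat_carrier, symmetric]
      indexed_mat_mult[OF assms])

lemma scalar_mat_eq_indexed_mat:
  assumes "distinct xs"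
  shows "c \<cdot>\<^sub>m 1\<^sub>m (length xs) = indexed_mat xs (\<lambda>x y. if x = y then c else (0 :: 'a :: semiring_1))"
  by (intro eq_matI) (auto simp: indexed_mat_def nth_eq_iff_index_eq[OF assms])

lemma det_indexed_mat_scalar:
  assumes "distinct xs"
  shows "det (indexed_mat xs (\<lambda>x y. if x = y then c else (0 :: 'a :: comm_ring_1))) = c ^ length xs"
  by (simp flip: scalar_mat_eq_indexed_mat[OF assms])

lemma det_indexed_mat_smult:
  "det (indexed_mat xs (\<lambda>x y. c * f x y)) = c ^ length xs * det (indexed_mat xs f :: 'a :: comm_ring_1 mat)"
proof -
  have "indexed_mat xs (\<lambda>x y. c * f x y) = c \<cdot>\<^sub>m indexed_mat xs f"
    by (intro eq_matI) (auto simp: indexed_mat_def)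
  then show ?thesis by simp
qed

lemma det_indexed_mat_uminus:
  "det (indexed_mat xs (\<lambda>x y. - f x y)) = (- 1) ^ length xs * det (indexed_mat xs f :: 'a :: comm_ring_1 mat)"
  using det_indexed_mat_smult[of xs "- 1" f] by simp

text \<open>Characteristic polynomials are compared through their values: the arc determinants need
  a square root of \<open>z - 1\<close>, which exists at each complex point \<open>z\<close> but not
  as a polynomial.\<close>

lemma poly_char_poly_indexed_mat:
  fixes f :: "'i \<Rightarrow> 'i \<Rightarrow> 'a :: field"
  assumes "distinct xs"
  shows "poly (char_poly (indexed_mat xs f)) z
    = det (indexed_mat xs (\<lambda>x y. (if x = y then z else 0) - f x y))"
proof -
  have "- char_matrix (indexed_mat xs f) z = indexed_mat xs (\<lambda>x y. (if x = y then z else 0) - f x y)"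
    by (intro eq_matI) (auto simp: char_matrix_def indexed_mat_def nth_eq_iff_index_eq[OF assms])
  then show ?thesis
    by (simp add: char_poly_matrix[OF indexed_mat_carrier])
qed

text \<open>Both sides are the determinant of the block matrix with rows \<open>(t, P)\<close> and \<open>(Q, 1)\<close>.\<close>

lemma det_sylvester:
  fixes P Q :: "'a :: idom mat"
  assumes P: "P \<in> carrier_mat n m" and Q: "Q \<in> carrier_mat m n"
  shows "t ^ m * det (t \<cdot>\<^sub>m 1\<^sub>m n - P * Q) = t ^ n * det (t \<cdot>\<^sub>m 1\<^sub>m m - Q * P)"
proof -
  let ?F = "four_block_mat (t \<cdot>\<^sub>m 1\<^sub>m n) P Q (1\<^sub>m m)"
  have F: "?F \<in> carrier_mat (n + m) (n + m)"
    by (intro four_block_carrier_mat) auto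
  have "?F * four_block_mat (1\<^sub>m n) (0\<^sub>m n m) (- Q) (1\<^sub>m m)
    = four_block_mat (t \<cdot>\<^sub>m 1\<^sub>m n - P * Q) P (0\<^sub>m m n) (1\<^sub>m m)"
    by (subst mult_four_block_mat) (use P Q in \<open>auto intro!: cong_four_block_mat\<close>)
  moreover have "det (four_block_mat (1\<^sub>m n) (0\<^sub>m n m) (- Q) (1\<^sub>m m)) = 1"
    by (subst det_four_block_mat_upper_right_zero) (use Q in auto)
  moreover have "four_block_mat (1\<^sub>m n) (0\<^sub>m n m) (- Q) (1\<^sub>m m) \<in> carrier_mat (n + m) (n + m)"
    by (intro four_block_carrier_mat) auto
  moreover have "det (four_block_mat (t \<cdot>\<^sub>m 1\<^sub>m n - P * Q) P (0\<^sub>m m n) (1\<^sub>m m))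
    = det (t \<cdot>\<^sub>m 1\<^sub>m n - P * Q)"
    by (subst det_four_block_mat_lower_left_zero) (use P Q in auto)
  ultimately have 1: "det ?F = det (t \<cdot>\<^sub>m 1\<^sub>m n - P * Q)"
    using det_mult[OF F] by (metis mult.right_neutral)
  have "?F * four_block_mat (1\<^sub>m n) (- P) (0\<^sub>m m n) (t \<cdot>\<^sub>m 1\<^sub>m m)
    = four_block_mat (t \<cdot>\<^sub>m 1\<^sub>m n) (0\<^sub>m n m) Q (t \<cdot>\<^sub>m 1\<^sub>m m - Q * P)"
    by (subst mult_four_block_mat) (use P Q in \<open>auto intro!: cong_four_block_mat\<close>)
  moreover have "det (four_block_mat (1\<^sub>m n) (- P) (0\<^sub>m m n) (t \<cdot>\<^sub>m 1\<^sub>m m)) = t ^ m"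
    by (subst det_four_block_mat_lower_left_zero) (use P in auto)
  moreover have "four_block_mat (1\<^sub>m n) (- P) (0\<^sub>m m n) (t \<cdot>\<^sub>m 1\<^sub>m m) \<in> carrier_mat (n + m) (n + m)"
    by (intro four_block_carrier_mat) auto
  moreover have "det (four_block_mat (t \<cdot>\<^sub>m 1\<^sub>m n) (0\<^sub>m n m) Q (t \<cdot>\<^sub>m 1\<^sub>m m - Q * P))
    = t ^ n * det (t \<cdot>\<^sub>m 1\<^sub>m m - Q * P)"
    by (subst det_four_block_mat_upper_right_zero) (use P Q in auto)
  ultimately have "det ?F * t ^ m = t ^ n * det (t \<cdot>\<^sub>m 1\<^sub>m m - Q * P)"
    using det_mult[OF F] by metis
  with 1 show ?thesis by (simp add: mult.commute)
qed

lemma det_sylvester_indexed: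
  fixes p :: "'i \<Rightarrow> 'j \<Rightarrow> 'a :: idom"
  assumes xs: "distinct xs" and ys: "distinct ys"
  shows "t ^ length ys *
      det (indexed_mat xs (\<lambda>x x'. (if x = x' then t else 0) - (\<Sum>y\<in>set ys. p x y * q y x')))
    = t ^ length xs *
      det (indexed_mat ys (\<lambda>y y'. (if y = y' then t else 0) - (\<Sum>x\<in>set xs. q y x * p x y')))"
proof -
  \<comment> \<open>Generic in both label types, since the two sides of Sylvester's identity use it
    with the lists exchanged.\<close>
  have *: "t \<cdot>\<^sub>m 1\<^sub>m (length xs) - rect_mat xs ys p * rect_mat ys xs q
      = indexed_mat xs (\<lambda>x x'. (if x = x' then t else 0) - (\<Sum>y\<in>set ys. p x y * q y x'))"
    if "distinct xs" "distinct ys" for xs :: "'k list" and ys :: "'l list" and p q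
    unfolding scalar_mat_eq_indexed_mat[OF that(1)] rect_mat_mult[OF that(2)]
    by (intro eq_matI) (auto simp: indexed_mat_def rect_mat_def)
  show ?thesis
    using det_sylvester[of "rect_mat xs ys p" "length xs" "length ys" "rect_mat ys xs q" t]
    unfolding *[OF xs ys] *[OF ys xs] by simp
qed

section \<open>Eigenvalue products and kernel vectors\<close>

lemma char_poly_eq_prod_proots:
  fixes A :: "complex mat"
  assumes "A \<in> carrier_mat n n"
  shows "char_poly A = (\<Prod>l\<in>#proots (char_poly A). [:- l, 1:])"
    and "size (proots (char_poly A)) = n"
  using complex_poly_decompose_multiset[of "char_poly A"] degree_monic_char_poly[OF assms]
  by (simp_all add: size_proots_complex)

lemma prod_mset_mult_const:
  "(\<Prod>x\<in>#M. c * f x) = c ^ size M * (\<Prod>x\<in>#M. f x :: 'a :: comm_monoid_mult)"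
  by (induction M) (auto simp: mult_ac)

lemma poly_prod_mset_image:
  "poly (\<Prod>x\<in>#M. f x) z = (\<Prod>x\<in>#M. poly (f x) z)"
  by (induction M) auto

text \<open>For \<open>s \<noteq> 0\<close> this is a rescaled value of the characteristic
  polynomial at \<open>c / s\<close>. The case \<open>s = 0\<close> must be covered because
  \<open>s\<close> will be a square root of \<open>z - 1\<close>, which vanishes at
  \<open>z = 1\<close>.\<close>

lemma det_indexed_mat_linear_factors:
  fixes f :: "'i \<Rightarrow> 'i \<Rightarrow> complex"
  assumes xs: "distinct xs"
  shows "det (indexed_mat xs (\<lambda>x y. (if x = y then c else 0) - s * f x y))
    = (\<Prod>l\<in>#proots (char_poly (indexed_mat xs f)). c - s * l)"
proof (cases "s = 0")
  case True
  then show ?thesis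
    by (simp add: det_indexed_mat_scalar[OF xs] char_poly_eq_prod_proots(2)[OF indexed_mat_carrier]
        prod_mset_mult_const[of c "\<lambda>_. 1", simplified])
next
  case False
  let ?A = "indexed_mat xs f"
  have "indexed_mat xs (\<lambda>x y. (if x = y then c else 0) - s * f x y)
    = s \<cdot>\<^sub>m indexed_mat xs (\<lambda>x y. (if x = y then c / s else 0) - f x y)"
    using False by (intro eq_matI) (auto simp: indexed_mat_def field_simps)
  then have "det (indexed_mat xs (\<lambda>x y. (if x = y then c else 0) - s * f x y))
    = s ^ length xs * poly (char_poly ?A) (c / s)"
    by (simp add: poly_char_poly_indexed_mat[OF xs])
  also have "poly (char_poly ?A) (c / s) = (\<Prod>l\<in>#proots (char_poly ?A). c / s - l)"
    by (subst char_poly_eq_prod_proots(1)[OF indexed_mat_carrier])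
      (simp add: poly_prod_mset_image)
  also have "s ^ length xs * \<dots> = (\<Prod>l\<in>#proots (char_poly ?A). s * (c / s - l))"
    by (simp add: prod_mset_mult_const char_poly_eq_prod_proots(2)[OF indexed_mat_carrier])
  also have "\<dots> = (\<Prod>l\<in>#proots (char_poly ?A). c - s * l)"
    using False by (simp add: algebra_simps)
  finally show ?thesis .
qed


lemma det_indexed_mat_eq_0D:
  fixes F :: "'i \<Rightarrow> 'i \<Rightarrow> 'a :: field"
  assumes xs: "distinct xs" and det: "det (indexed_mat xs F) = 0"
  obtains f where "\<exists>x\<in>set xs. f x \<noteq> 0" "\<And>x. x \<in> set xs \<Longrightarrow> (\<Sum>y\<in>set xs. F x y * f y) = 0"
proof -
  obtain v where v: "v \<in> carrier_vec (length xs)" "v \<noteq> 0\<^sub>v (length xs)"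
    "indexed_mat xs F *\<^sub>v v = 0\<^sub>v (length xs)"
    using det det_0_iff_vec_prod_zero_field[OF indexed_mat_carrier] by blast
  \<comment> \<open>\<open>the_inv_into\<close> recovers the position of a label, turning the kernel
    vector into a function on labels.\<close>
  define f where "f x = v $ the_inv_into {..<length xs} (nth xs) x" for x
  have f: "f (xs ! i) = v $ i" if "i < length xs" for i
    unfolding f_def using that xs by (subst the_inv_into_f_f) (auto intro: inj_on_nth)
  from v(1,2) obtain i where "i < length xs" "v $ i \<noteq> 0"
    by (metis carrier_vecD dim_vec eq_vecI index_zero_vec zero_vec_def)
  then have "\<exists>x\<in>set xs. f x \<noteq> 0"
    using f by (metis nth_mem)
  moreover have "(\<Sum>y\<in>set xs. F x y * f y) = 0" if "x \<in> set xs" for x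
  proof -
    from that obtain i where i: "i < length xs" "x = xs ! i"
      by (metis in_set_conv_nth)
    have "(\<Sum>y\<in>set xs. F x y * f y) = (\<Sum>j = 0..<length xs. F x (xs ! j) * v $ j)"
      by (simp add: f flip: sum_nth_distinct[OF xs])
    also have "\<dots> = (indexed_mat xs F *\<^sub>v v) $ i"
      using i v(1) by (simp add: indexed_mat_def scalar_prod_def)
    finally show ?thesis using v(3) i(1) by simp
  qed
  ultimately show thesis by (rule that)
qed

section \<open>The eigenvalue pairs of item (ii)\<close>

text \<open>A multiset, so that \<open>l = 0\<close> or a vanishing square root gives the common
  value twice.\<close>

definition walk_eigenvalues :: "nat \<Rightarrow> complex \<Rightarrow> complex multiset" where
  "walk_eigenvalues k l =
    {# (l^2 - 2 * of_nat k + 4) / 2 + l * csqrt (l^2 - 4 * (of_nat k - 1)) / 2,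
       (l^2 - 2 * of_nat k + 4) / 2 - l * csqrt (l^2 - 4 * (of_nat k - 1)) / 2 #}"

text \<open>With \<open>t = z - 2\<close> and \<open>x\<^sup>2 = z - 1\<close> the right side is
  \<open>(t + k - x * l) * (t + k + x * l)\<close>, the contribution of \<open>l\<close> to the two
  vertex determinants.\<close>

lemma prod_walk_eigenvalues:
  "(\<Prod>m\<in>#walk_eigenvalues k l. z - m) = (z - 2 + of_nat k)\<^sup>2 - (z - 1) * l\<^sup>2"
proof -
  define r where "r = csqrt (l^2 - 4 * (of_nat k - 1))"
  have r: "r\<^sup>2 = l\<^sup>2 - 4 * (of_nat k - 1)"
    by (simp add: r_def)
  define p where "p = (l\<^sup>2 - 2 * of_nat k + 4) / 2"
  have "(\<Prod>m\<in>#walk_eigenvalues k l. z - m) = (z - (p + l * r / 2)) * (z - (p - l * r / 2))"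
    by (simp add: walk_eigenvalues_def r_def p_def)
  \<comment> \<open>Only \<open>r\<^sup>2\<close> survives, so the choice of square root does not
    affect the product.\<close>
  also have "\<dots> = (z - p)\<^sup>2 - l\<^sup>2 * r\<^sup>2 / 4"
    by (simp add: field_simps power2_eq_square)
  also have "\<dots> = (z - 2 + of_nat k)\<^sup>2 - (z - 1) * l\<^sup>2"
    unfolding r p_def by (simp add: field_simps power2_eq_square) algebra
  finally show ?thesis .
qed

text \<open>The discriminant at \<open>l = k\<close> is \<open>(k - 2)\<^sup>2\<close>, and
  \<open>k \<ge> 2\<close> makes \<open>k - 2\<close> its principal root.\<close>

lemma walk_eigenvalues_valency:
  assumes "k \<ge> 2"
  shows "walk_eigenvalues k (of_nat k) = {# (of_nat k)\<^sup>2 - 2 * of_nat k + 2, 2 #}"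
proof -
  have "(of_nat k)\<^sup>2 - 4 * (of_nat k - 1) = (complex_of_real (real k - 2))\<^sup>2" (is "?a = ?b")
    by (simp add: power2_eq_square algebra_simps)
  moreover have "csqrt ?b = of_real (real k - 2)"
    using assms by (simp add: csqrt_of_real_nonneg flip: of_real_power)
  ultimately have root: "csqrt ?a = of_nat k - 2"
    by simp
  show ?thesis
    unfolding walk_eigenvalues_def root by (simp add: power2_eq_square field_simps)
qed

text \<open>Sylvester's identity leaves spare powers of a linear factor on both sides. They are
  cancelled between polynomials, since at single points the factor may be zero.\<close>

lemma linear_power_cancel:
  "[:a, 1:] ^ m * p = [:a, 1:] ^ m * q \<Longrightarrow> p = (q :: 'a :: idom poly)"
  by simp

lemma proots_prod_linear: "proots (\<Prod>m\<in>#M. [:- m, 1:]) = M"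
proof (induction M)
  case (add m M)
  have "(\<Prod>m\<in>#M. [:- m, 1:]) \<noteq> 0"
    by (auto simp: prod_mset_zero_iff)
  with add show ?case
    by (simp add: proots_mult del: mult_pCons_left)
qed simp

lemma proots_prod_walk_eigenvalues:
  "proots (\<Prod>l\<in>#M. \<Prod>m\<in>#walk_eigenvalues k l. [:- m, 1:])
    = (\<Sum>l\<in>#M. walk_eigenvalues k l)"
proof -
  have "(\<Prod>l\<in>#M. \<Prod>m\<in>#walk_eigenvalues k l. [:- m, 1:])
    = (\<Prod>m\<in>#(\<Sum>l\<in>#M. walk_eigenvalues k l). [:- m, 1:])"
    by (induction M) simp_all
  then show ?thesis
    by (simp only: proots_prod_linear)
qed

section \<open>The nonbacktracking matrix and the arcs of a regular graph\<close>

text \<open>Hashimoto's edge matrix, oriented as \<open>transition_entry\<close>: the column arc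
  \<open>f\<close> comes first and the row arc \<open>e\<close> follows it.\<close>

definition nonbacktracking :: "'v \<times> 'v \<Rightarrow> 'v \<times> 'v \<Rightarrow> 'a :: comm_ring_1" where
  "nonbacktracking e f = of_bool (snd f = fst e \<and> fst f \<noteq> snd e)"

lemma nonbacktracking_eq:
  "nonbacktracking e f = of_bool (snd f = fst e) - of_bool (e = prod.swap f)"
  by (cases e; cases f) (auto simp: nonbacktracking_def)

lemma swap_eq_iff: "prod.swap e = f \<longleftrightarrow> e = prod.swap f"
  by (cases e; cases f) auto

lemma if_eq_of_bool: "(if b then x else 0) = of_bool b * (x :: 'a :: comm_ring_1)"
  by simp

text \<open>The graph as plain lists, on which determinants and counts are taken. Connectedness is
  added later, as a condition on functions constant along arcs.\<close>

locale regular_arcs =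
  fixes vs :: "'v list" and es :: "('v \<times> 'v) list" and k :: nat
  assumes distinct_vs: "distinct vs" and distinct_es: "distinct es"
    and arcs_subset: "set es \<subseteq> set vs \<times> set vs"
    and sym_arcs: "(u, v) \<in> set es \<Longrightarrow> (v, u) \<in> set es"
    and regular: "v \<in> set vs \<Longrightarrow> card {w. (v, w) \<in> set es} = k"
begin

text \<open>Polymorphic in the ring: the spectrum is complex, while the proof that \<open>k\<close>
  is simple uses the order of the reals.\<close>

definition adj :: "'v \<Rightarrow> 'v \<Rightarrow> 'a :: comm_ring_1" where
  "adj u v = of_bool ((u, v) \<in> set es)"

lemma swap_arc [simp]: "prod.swap e \<in> set es \<longleftrightarrow> e \<in> set es"
  by (cases e) (auto intro: sym_arcs)

lemma adj_commute: "adj u v = adj v u"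
  using sym_arcs[of u v] sym_arcs[of v u] by (auto simp: adj_def)

lemma card_in_arcs:
  assumes "u \<in> set vs"
  shows "card {e \<in> set es. snd e = u} = k"
proof -
  have "{e \<in> set es. snd e = u} = (\<lambda>w. (w, u)) ` {w. (u, w) \<in> set es}"
    using sym_arcs by force
  then show ?thesis
    using regular[OF assms] by (simp add: card_image inj_on_def)
qed

lemma length_es: "length es = length vs * k"
proof -
  have "length es = (\<Sum>e\<in>set es. 1)"
    by (simp add: distinct_card[OF distinct_es])
  also have "\<dots> = (\<Sum>u\<in>set vs. \<Sum>e | e \<in> set es \<and> snd e = u. 1)"
    using arcs_subset by (intro sum.group[symmetric]) auto
  also have "\<dots> = length vs * k"
    by (simp add: card_in_arcs distinct_card[OF distinct_vs])
  finally show ?thesis .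
qed

lemma sum_adj_out:
  assumes "u \<in> set vs"
  shows "(\<Sum>v\<in>set vs. adj u v) = of_nat k"
proof -
  have "(\<Sum>v\<in>set vs. adj u v) = (of_nat (card (set vs \<inter> {v. (u, v) \<in> set es})) :: 'a :: comm_ring_1)"
    by (simp add: adj_def of_bool_def sum.If_cases)
  also have "set vs \<inter> {v. (u, v) \<in> set es} = {v. (u, v) \<in> set es}"
    using arcs_subset by auto
  finally show ?thesis by (simp add: regular[OF assms])
qed

lemma sum_adj_in:
  assumes "v \<in> set vs"
  shows "(\<Sum>u\<in>set vs. adj u v) = of_nat k"
  using sum_adj_out[OF assms] by (simp only: adj_commute[of _ v])

section \<open>The Ihara--Bass determinant identities\<close>

text \<open>Left multiplication by \<open>x - J\<close>, with \<open>J\<close> the arc reversal: row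
  \<open>e\<close> is supported on \<open>e\<close> and its reverse.\<close>

lemma sum_reversal:
  fixes F :: "'v \<times> 'v \<Rightarrow> 'a :: comm_ring_1"
  assumes "e \<in> set es"
  shows "(\<Sum>g\<in>set es. ((if e = g then x else 0) - of_bool (e = prod.swap g)) * F g)
    = x * F e - F (prod.swap e)"
proof -
  have "(\<Sum>g\<in>set es. ((if e = g then x else 0) - of_bool (e = prod.swap g)) * F g)
    = (\<Sum>g\<in>set es. (if g = e then x * F e else 0) - (if g = prod.swap e then F g else 0))"
    by (intro sum.cong) (auto simp: algebra_simps)
  then show ?thesis
    using assms by (simp add: sum_subtractf)
qed

text \<open>The middle arc of a two-step walk from \<open>f\<close> to \<open>e\<close> can only be
  \<open>(snd f, fst e)\<close>, so the sum has at most one nonzero term.\<close>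

lemma nonbacktracking_square:
  assumes "e \<in> set es" "f \<in> set es"
  shows "(\<Sum>g\<in>set es. nonbacktracking e g * nonbacktracking g f)
    = of_bool ((snd f, fst e) \<in> set es \<and> snd f \<noteq> snd e \<and> fst f \<noteq> fst e)"
proof -
  have "(\<Sum>g\<in>set es. nonbacktracking e g * nonbacktracking g f)
    = (\<Sum>g\<in>set es. if g = (snd f, fst e) then of_bool (snd f \<noteq> snd e \<and> fst f \<noteq> fst e) else 0)"
    by (intro sum.cong) (auto simp: nonbacktracking_def)
  then show ?thesis by auto
qed

text \<open>
  With \<open>J\<close> the arc reversal and \<open>B\<close> the nonbacktracking matrix, \<open>B + J\<close> factors through the vertices;
  since \<open>J\<^sup>2 = 1\<close>, so does \<open>(x - J) * (x - B) - (x\<^sup>2 - 1)\<close>, and Sylvester's identity applies.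
\<close>

lemma det_nonbacktracking:
  fixes x :: "'a :: idom"
  defines "t \<equiv> x\<^sup>2 - 1"
  shows "t ^ length vs *
      (det (indexed_mat es (\<lambda>e f. (if e = f then x else 0) - of_bool (e = prod.swap f))) *
       det (indexed_mat es (\<lambda>e f. (if e = f then x else 0) - nonbacktracking e f)))
    = t ^ length es *
      det (indexed_mat vs (\<lambda>u v. (if u = v then t + of_nat k else 0) - x * adj u v))"
proof -
  \<comment> \<open>\<open>(x - J) * (x - B) = t - (x * (B + J) - J * (B + J))\<close>; here
    \<open>B + J\<close> tests \<open>snd f = fst e\<close>, and \<open>J\<close> on the left
    replaces \<open>fst e\<close> by \<open>snd e\<close>. Hence the two terms of
    \<open>?p\<close>.\<close>
  let ?p = "\<lambda>e v. x * of_bool (fst e = v) - of_bool (snd e = v) :: 'a"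
  let ?q = "\<lambda>v e. of_bool (snd e = v) :: 'a"
  have sum_q: "(\<Sum>v\<in>set vs. ?p e v * ?q v f) = ?p e (snd f)" if "f \<in> set es" for e f
  proof -
    have "(\<Sum>v\<in>set vs. ?p e v * ?q v f) = (\<Sum>v\<in>set vs. if v = snd f then ?p e v else 0)"
      by (intro sum.cong) auto
    then show ?thesis using that arcs_subset by auto
  qed
  have "(\<Sum>g\<in>set es. ((if e = g then x else 0) - of_bool (e = prod.swap g)) *
        ((if g = f then x else 0) - nonbacktracking g f))
      = (if e = f then t else 0) - (\<Sum>v\<in>set vs. ?p e v * ?q v f)"
    if "e \<in> set es" "f \<in> set es" for e f
    unfolding sum_reversal[OF that(1)] sum_q[OF that(2)] nonbacktracking_eq t_def
    unfolding if_eq_of_bool swap_eq_iff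
    by (simp add: algebra_simps power2_eq_square eq_commute[of "snd f"] swap_eq_iff)
  then have "det (indexed_mat es (\<lambda>e f. (if e = f then x else 0) - of_bool (e = prod.swap f))) *
       det (indexed_mat es (\<lambda>e f. (if e = f then x else 0) - nonbacktracking e f))
     = det (indexed_mat es (\<lambda>e f. (if e = f then t else 0) - (\<Sum>v\<in>set vs. ?p e v * ?q v f)))"
    unfolding det_indexed_mat_mult[OF distinct_es] by (intro arg_cong[of _ _ det] indexed_mat_cong)
  \<comment> \<open>In the opposite order the sum runs over the arcs with head \<open>u\<close>:
    their tails produce \<open>x * adj u v\<close>, their number \<open>k\<close> the diagonal
    shift.\<close>
  moreover have "(if u = v then t else 0) - (\<Sum>e\<in>set es. ?q u e * ?p e v)
      = (if u = v then t + of_nat k else 0) - x * adj u v" if "u \<in> set vs" for u v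
  proof -
    have "(\<Sum>e\<in>set es. ?q u e * ?p e v)
      = (\<Sum>e\<in>set es. (if e = (v, u) then x else 0) - (if snd e = u then of_bool (u = v) else 0))"
      by (intro sum.cong) auto
    also have "\<dots> = x * adj v u - (if u = v then of_nat (card {e \<in> set es. snd e = u}) else 0)"
      by (auto simp: sum_subtractf adj_def sum.If_cases Int_def)
    finally have *: "(\<Sum>e\<in>set es. ?q u e * ?p e v) = x * adj u v - (if u = v then of_nat k else 0)"
      by (simp only: card_in_arcs[OF that] adj_commute[of v])
    show ?thesis
      unfolding * by simp
  qed
  then have "det (indexed_mat vs (\<lambda>u v. (if u = v then t else 0) - (\<Sum>e\<in>set es. ?q u e * ?p e v)))
    = det (indexed_mat vs (\<lambda>u v. (if u = v then t + of_nat k else 0) - x * adj u v))"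
    by (intro arg_cong[of _ _ det] indexed_mat_cong)
  ultimately show ?thesis
    using det_sylvester_indexed[OF distinct_es distinct_vs, of t ?p ?q] by simp
qed

text \<open>Multiplies the identities of \<open>det_nonbacktracking\<close> at \<open>x\<close> and
  \<open>- x\<close>, which share \<open>t\<close>. Here \<open>(x - J) * (- x - J) = - t\<close>
  and \<open>(x - B) * (- x - B) = B\<^sup>2 - x\<^sup>2\<close>, so the signs cancel and a factor
  \<open>t ^ length es\<close> stays on the left.\<close>

lemma det_nonbacktracking_square:
  fixes x :: "'a :: idom"
  defines "t \<equiv> x\<^sup>2 - 1"
  shows "t ^ (2 * length vs + length es) *
      det (indexed_mat es (\<lambda>e f. (if e = f then x\<^sup>2 else 0) -
        (\<Sum>g\<in>set es. nonbacktracking e g * nonbacktracking g f)))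
    = t ^ (2 * length es) *
      (det (indexed_mat vs (\<lambda>u v. (if u = v then t + of_nat k else 0) - x * adj u v)) *
       det (indexed_mat vs (\<lambda>u v. (if u = v then t + of_nat k else 0) - (- x) * adj u v)))"
proof -
  let ?P = "\<lambda>x. det (indexed_mat es (\<lambda>e f. (if e = f then x else 0) - of_bool (e = prod.swap f))) :: 'a"
  let ?F = "\<lambda>x. det (indexed_mat es (\<lambda>e f. (if e = f then x else 0) - nonbacktracking e f)) :: 'a"
  let ?R = "\<lambda>x. det (indexed_mat vs (\<lambda>u v. (if u = v then t + of_nat k else 0) - x * adj u v)) :: 'a"
  let ?N = "\<lambda>e f. (\<Sum>g\<in>set es. nonbacktracking e g * nonbacktracking g f) :: 'a"
  let ?D = "det (indexed_mat es (\<lambda>e f. (if e = f then x\<^sup>2 else 0) - ?N e f))"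
  have R: "t ^ length vs * (?P x * ?F x) = t ^ length es * ?R x"
    "t ^ length vs * (?P (- x) * ?F (- x)) = t ^ length es * ?R (- x)"
    unfolding t_def using det_nonbacktracking[of x] det_nonbacktracking[of "- x"]
    by (simp_all only: power2_minus)
  have "(\<Sum>g\<in>set es. ((if e = g then x else 0) - of_bool (e = prod.swap g)) *
        ((if g = f then - x else 0) - of_bool (g = prod.swap f)))
      = (if e = f then - t else 0)" if "e \<in> set es" for e f
    unfolding sum_reversal[OF that] t_def unfolding if_eq_of_bool swap_eq_iff
    by (simp add: algebra_simps power2_eq_square swap_eq_iff)
  then have "?P x * ?P (- x) = det (indexed_mat es (\<lambda>e f. if e = f then - t else 0))"
    unfolding det_indexed_mat_mult[OF distinct_es] by (intro arg_cong[of _ _ det] indexed_mat_cong)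
  then have P: "?P x * ?P (- x) = (- t) ^ length es"
    by (simp add: det_indexed_mat_scalar[OF distinct_es])
  have "(\<Sum>g\<in>set es. ((if e = g then x else 0) - nonbacktracking e g) *
        ((if g = f then - x else 0) - nonbacktracking g f))
      = - ((if e = f then x\<^sup>2 else 0) - ?N e f)" if "e \<in> set es" "f \<in> set es" for e f
  proof -
    have "(\<Sum>g\<in>set es. ((if e = g then x else 0) - nonbacktracking e g) *
        ((if g = f then - x else 0) - nonbacktracking g f))
      = (\<Sum>g\<in>set es. (if g = e then - (if e = f then x\<^sup>2 else 0) - x * nonbacktracking e f else 0)
         + (if g = f then x * nonbacktracking e f else 0) + nonbacktracking e g * nonbacktracking g f)"
      by (intro sum.cong) (auto simp: algebra_simps power2_eq_square)
    then show ?thesis using that by (simp add: sum.distrib)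
  qed
  then have "?F x * ?F (- x) = det (indexed_mat es (\<lambda>e f. - ((if e = f then x\<^sup>2 else 0) - ?N e f)))"
    unfolding det_indexed_mat_mult[OF distinct_es] by (intro arg_cong[of _ _ det] indexed_mat_cong)
  then have F: "?F x * ?F (- x) = (- 1) ^ length es * ?D"
    by (simp only: det_indexed_mat_uminus)
  have sq: "t ^ (2 * m) = t ^ m * t ^ m" for m
    by (simp add: mult_2 power_add)
  have "t ^ (2 * length vs + length es) * ?D
    = t ^ (2 * length vs) * ((- t) ^ length es * ((- 1) ^ length es * ?D))"
    by (simp add: power_add mult_ac flip: power_mult_distrib)
  also have "\<dots> = (t ^ length vs * (?P x * ?F x)) * (t ^ length vs * (?P (- x) * ?F (- x)))"
    unfolding P[symmetric] F[symmetric] sq by (simp only: mult_ac)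
  also have "\<dots> = t ^ (2 * length es) * (?R x * ?R (- x))"
    unfolding R sq by (simp only: mult_ac)
  finally show ?thesis .
qed


lemma char_poly_nonbacktracking_square_plus_one:
  assumes "k \<ge> 2"
  shows "char_poly (indexed_mat es
      (\<lambda>e f. of_bool (e = f) + (\<Sum>g\<in>set es. nonbacktracking e g * nonbacktracking g f)))
    = [:-2, 1:] ^ (length vs * (k - 2)) *
      (\<Prod>l\<in>#proots (char_poly (indexed_mat vs adj)).
        \<Prod>m\<in>#walk_eigenvalues k l. [:- m, 1:])"
    (is "char_poly (indexed_mat es ?S) = ?t ^ _ * ?Q")
proof -
  let ?M = "proots (char_poly (indexed_mat vs adj :: complex mat))"
  have "?t ^ (2 * length vs + length es) * char_poly (indexed_mat es ?S)
    = ?t ^ (2 * length es) * ?Q"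
    (is "?lhs = ?rhs")
  proof -
    have "poly ?lhs z = poly ?rhs z" for z
    proof -
      \<comment> \<open>The added identity matrix shifts the argument: \<open>B\<^sup>2\<close> is
        evaluated at \<open>z - 1\<close>, so \<open>t = z - 2\<close>, which is \<open>?t\<close>
        at \<open>z\<close>.\<close>
      define x where "x = csqrt (z - 1)"
      have x: "x\<^sup>2 = z - 1" by (simp add: x_def)
      have "(if e = f then z else 0) - ?S e f = (if e = f then x\<^sup>2 else 0) -
          (\<Sum>g\<in>set es. nonbacktracking e g * nonbacktracking g f)" for e f
        by (simp add: x)
      then have "poly (char_poly (indexed_mat es ?S)) z
        = det (indexed_mat es (\<lambda>e f. (if e = f then x\<^sup>2 else 0) -
            (\<Sum>g\<in>set es. nonbacktracking e g * nonbacktracking g f)))"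
        by (simp only: poly_char_poly_indexed_mat[OF distinct_es])
      then have "poly ?lhs z = (z - 2) ^ (2 * length es) *
          ((\<Prod>l\<in>#?M. z - 2 + of_nat k - x * l) * (\<Prod>l\<in>#?M. z - 2 + of_nat k - (- x) * l))"
        using det_nonbacktracking_square[of x]
        unfolding det_indexed_mat_linear_factors[OF distinct_vs]
        by (simp add: x)
      \<comment> \<open>Pairing the factors of the same eigenvalue leaves only
        \<open>x\<^sup>2\<close>, hence a polynomial in \<open>z\<close>.\<close>
      also have "(\<Prod>l\<in>#?M. z - 2 + of_nat k - x * l) * (\<Prod>l\<in>#?M. z - 2 + of_nat k - (- x) * l)
        = (\<Prod>l\<in>#?M. (z - 2 + of_nat k)\<^sup>2 - (z - 1) * l\<^sup>2)"
        unfolding prod_mset.distrib[symmetric] x[symmetric]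
        by (simp add: algebra_simps power2_eq_square)
      finally show ?thesis
        by (simp add: poly_prod_mset_image flip: prod_walk_eigenvalues)
    qed
    then show ?thesis
      by (intro poly_eq_poly_eq_iff[THEN iffD1] ext)
  qed
  \<comment> \<open>\<open>length es = length vs * k\<close> leaves the exponent
    \<open>length vs * (k - 2)\<close>, the multiplicity in item (iii) before \<open>l = k\<close>
    adds its share.\<close>
  moreover have "?t ^ (2 * length es) = ?t ^ (2 * length vs + length es) * ?t ^ (length vs * (k - 2))"
  proof -
    obtain j where "k = 2 + j" using assms le_Suc_ex by blast
    then have "2 * length es = (2 * length vs + length es) + length vs * (k - 2)"
      by (simp add: length_es algebra_simps)
    then show ?thesis by (simp only: power_add)
  qed
  ultimately have "?t ^ (2 * length vs + length es) * char_poly (indexed_mat es ?S)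
    = ?t ^ (2 * length vs + length es) * (?t ^ (length vs * (k - 2)) * ?Q)"
    by (simp only: mult.assoc)
  then show ?thesis
    by (rule linear_power_cancel)
qed

section \<open>Simplicity of the eigenvalue \<open>k\<close>\<close>

text \<open>Since \<open>A\<close> maps the all-ones vector to \<open>k\<close> times itself,
  \<open>(z - A) * (z - k + 1 1\<^sup>T) = (z - k) * (z - A + 1 1\<^sup>T)\<close>.\<close>

lemma char_poly_minus_ones:
  "char_poly (indexed_mat vs adj) * [:of_nat (length vs) - of_nat k, 1:]
    = [:- of_nat k, 1:] * char_poly (indexed_mat vs (\<lambda>u v. adj u v - 1 :: 'a :: field_char_0))"
    (is "?p * ?n = ?t * ?q")
proof -
  have "poly (?t ^ length vs * (?p * ?n)) z = poly (?t ^ length vs * (?t * ?q)) z" for z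
  proof -
    let ?s = "z - of_nat k"
    let ?A = "det (indexed_mat vs (\<lambda>u v. (if u = v then z else 0) - adj u v))"
    let ?B = "det (indexed_mat vs (\<lambda>u v. (if u = v then z else 0) - (adj u v - 1)))"
    let ?C = "det (indexed_mat vs (\<lambda>u v. (if u = v then ?s else 0) + 1))"
    have single: "det (indexed_mat [()] f) = f () ()" for f :: "unit \<Rightarrow> unit \<Rightarrow> 'a"
      by (subst det_single) (auto simp: indexed_mat_def)
    \<comment> \<open>The rank-one matrix \<open>1 1\<^sup>T\<close> factors through a one-element
      index set, so Sylvester's identity reduces \<open>?C\<close> to a 1 by 1 determinant.\<close>
    have C: "?s * ?C = ?s ^ length vs * (?s + of_nat (length vs))"
      using det_sylvester_indexed[of vs "[()]" ?s "\<lambda>_ _. 1" "\<lambda>_ _. - 1"]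
      by (simp add: distinct_vs single distinct_card)
    have "(\<Sum>v\<in>set vs. ((if u = v then z else 0) - adj u v) * ((if v = w then ?s else 0) + 1))
      = ?s * ((if u = w then z else 0) - (adj u w - 1))" if "u \<in> set vs" "w \<in> set vs" for u w
    proof -
      have "(\<Sum>v\<in>set vs. ((if u = v then z else 0) - adj u v) * ((if v = w then ?s else 0) + 1))
        = (\<Sum>v\<in>set vs. (if v = w then ((if u = w then z else 0) - adj u w) * ?s else 0)
            + (if v = u then z else 0) - adj u v)"
        by (intro sum.cong) (auto simp: algebra_simps)
      then show ?thesis
        using that by (simp add: sum.distrib sum_subtractf sum_adj_out algebra_simps)
    qed
    then have "?A * ?C = det (indexed_mat vs (\<lambda>u v. ?s * ((if u = v then z else 0) - (adj u v - 1))))"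
      unfolding det_indexed_mat_mult[OF distinct_vs] by (intro arg_cong[of _ _ det] indexed_mat_cong)
    also have "\<dots> = ?s ^ length vs * ?B"
      by (simp add: det_indexed_mat_smult)
    finally have AC: "?A * ?C = ?s ^ length vs * ?B" .
    have "?s ^ length vs * (?A * (?s + of_nat (length vs))) = ?A * (?s * ?C)"
      unfolding C by (simp add: mult_ac)
    also have "\<dots> = ?s * (?A * ?C)"
      by (simp add: mult_ac)
    also have "\<dots> = ?s ^ length vs * (?s * ?B)"
      unfolding AC by (simp add: mult_ac)
    finally show ?thesis
      by (simp add: poly_char_poly_indexed_mat[OF distinct_vs] poly_power algebra_simps)
  qed
  then have "?t ^ length vs * (?p * ?n) = ?t ^ length vs * (?t * ?q)"
    by (intro poly_eq_poly_eq_iff[THEN iffD1] ext)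
  then show ?thesis
    by (rule linear_power_cancel)
qed

text \<open>The Dirichlet form of \<open>f\<close> vanishes.\<close>

lemma harmonic_imp_locally_constant:
  fixes f :: "'v \<Rightarrow> real"
  assumes harmonic: "\<And>u. u \<in> set vs \<Longrightarrow> (\<Sum>v\<in>set vs. adj u v * f v) = of_nat k * f u"
    and "(u, v) \<in> set es"
  shows "f u = f v"
proof -
  have 1: "(\<Sum>u\<in>set vs. \<Sum>v\<in>set vs. adj u v * (f u)\<^sup>2) = real k * (\<Sum>u\<in>set vs. (f u)\<^sup>2)"
    by (simp add: sum_adj_out sum_distrib_left flip: sum_distrib_right)
  have 2: "(\<Sum>u\<in>set vs. \<Sum>v\<in>set vs. adj u v * (f v)\<^sup>2) = real k * (\<Sum>u\<in>set vs. (f u)\<^sup>2)"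
    by (subst sum.swap) (simp add: sum_adj_in sum_distrib_left flip: sum_distrib_right)
  have 3: "(\<Sum>u\<in>set vs. \<Sum>v\<in>set vs. adj u v * (f u * f v)) = real k * (\<Sum>u\<in>set vs. (f u)\<^sup>2)"
  proof -
    have "(\<Sum>v\<in>set vs. adj u v * (f u * f v)) = real k * (f u)\<^sup>2" if "u \<in> set vs" for u
    proof -
      have "(\<Sum>v\<in>set vs. adj u v * (f u * f v)) = f u * (\<Sum>v\<in>set vs. adj u v * f v)"
        by (simp add: sum_distrib_left mult_ac)
      then show ?thesis
        using harmonic[OF that] by (simp add: power2_eq_square)
    qed
    then show ?thesis by (simp add: sum_distrib_left)
  qed
  \<comment> \<open>The terms are nonnegative, while the expansion gives
    \<open>(1 + 1 - 2) * k\<close> times the sum of squares.\<close>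
  have "(\<Sum>u\<in>set vs. \<Sum>v\<in>set vs. adj u v * (f u - f v)\<^sup>2)
    = (\<Sum>u\<in>set vs. \<Sum>v\<in>set vs. adj u v * (f u)\<^sup>2 + adj u v * (f v)\<^sup>2 - 2 * (adj u v * (f u * f v)))"
    by (simp add: power2_eq_square algebra_simps)
  also have "\<dots> = 0"
    by (simp add: sum.distrib sum_subtractf 1 2 3 flip: sum_distrib_left)
  finally have "(\<Sum>v\<in>set vs. adj u v * (f u - f v)\<^sup>2) = 0" if "u \<in> set vs" for u
    using that by (subst (asm) sum_nonneg_eq_0_iff) (auto intro!: sum_nonneg simp: adj_def)
  then have "adj u v * (f u - f v)\<^sup>2 = 0"
    using assms(2) arcs_subset by (subst (asm) sum_nonneg_eq_0_iff) (auto simp: adj_def)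
  then show ?thesis
    using assms(2) by (simp add: adj_def)
qed

text \<open>A kernel vector \<open>f\<close> satisfies \<open>A f = k f + s 1\<close> with
  \<open>s\<close> the sum of its entries. Summing over all vertices forces \<open>s = 0\<close>;
  then \<open>f\<close> is constant by the Dirichlet form and connectedness, hence zero.\<close>

lemma det_minus_ones_nonzero:
  assumes "vs \<noteq> []"
    and connected: "\<And>(f :: 'v \<Rightarrow> real) u v. (\<And>u v. (u, v) \<in> set es \<Longrightarrow> f u = f v)
      \<Longrightarrow> u \<in> set vs \<Longrightarrow> v \<in> set vs \<Longrightarrow> f u = f v"
  shows "det (indexed_mat vs (\<lambda>u v. (if u = v then of_nat k else 0) - (adj u v - 1) :: real)) \<noteq> 0"
proof
  assume "det (indexed_mat vs (\<lambda>u v. (if u = v then of_nat k else 0) - (adj u v - 1) :: real)) = 0"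
  then obtain f where f: "\<exists>x\<in>set vs. f x \<noteq> 0"
    and eq: "\<And>u. u \<in> set vs \<Longrightarrow>
      (\<Sum>v\<in>set vs. ((if u = v then of_nat k else 0) - (adj u v - 1)) * f v) = (0 :: real)"
    using det_indexed_mat_eq_0D[OF distinct_vs] by blast
  define s where "s = sum f (set vs)"
  have eq': "(\<Sum>v\<in>set vs. adj u v * f v) = k * f u + s" if "u \<in> set vs" for u
  proof -
    have "(\<Sum>v\<in>set vs. ((if u = v then of_nat k else 0) - (adj u v - 1)) * f v)
      = (\<Sum>v\<in>set vs. (if v = u then k * f u else 0) - adj u v * f v + f v)"
      by (intro sum.cong) (auto simp: algebra_simps)
    with eq[OF that] that show ?thesis
      by (simp add: sum.distrib sum_subtractf s_def)
  qed
  have "(\<Sum>u\<in>set vs. \<Sum>v\<in>set vs. adj u v * f v) = k * s"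
    by (subst sum.swap) (simp add: s_def sum_distrib_left sum_adj_in flip: sum_distrib_right)
  moreover have "(\<Sum>u\<in>set vs. \<Sum>v\<in>set vs. adj u v * f v) = k * s + length vs * s"
    by (simp add: eq' sum.distrib distinct_card[OF distinct_vs] s_def flip: sum_distrib_left)
  ultimately have "s = 0"
    using assms(1) by simp
  have const: "f u = f v" if "u \<in> set vs" "v \<in> set vs" for u v
  proof (rule connected[OF _ that])
    show "f u = f v" if "(u, v) \<in> set es" for u v
      using harmonic_imp_locally_constant[OF _ that] eq' \<open>s = 0\<close> by simp
  qed
  from f obtain u where u: "u \<in> set vs" "f u \<noteq> 0" by blast
  have "s = (\<Sum>v\<in>set vs. f u)"
    unfolding s_def by (rule sum.cong[OF refl]) (rule const[OF _ u(1)])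
  then have "of_nat (card (set vs)) * f u = 0"
    using \<open>s = 0\<close> by simp
  with u assms(1) show False by simp
qed

text \<open>Orders at \<open>k\<close> are compared in \<open>char_poly_minus_ones\<close>: on the
  right only the linear factor vanishes there, and the extra factor on the left takes the value
  \<open>length vs \<noteq> 0\<close>.\<close>

lemma count_valency_eigenvalue:
  assumes "vs \<noteq> []"
    and "\<And>(f :: 'v \<Rightarrow> real) u v. (\<And>u v. (u, v) \<in> set es \<Longrightarrow> f u = f v)
      \<Longrightarrow> u \<in> set vs \<Longrightarrow> v \<in> set vs \<Longrightarrow> f u = f v"
  shows "count (proots (char_poly (indexed_mat vs adj :: complex mat))) (of_nat k) = 1"
proof -
  let ?p = "char_poly (indexed_mat vs adj :: complex mat)"
  let ?q = "char_poly (indexed_mat vs (\<lambda>u v. adj u v - 1 :: complex))"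
  \<comment> \<open>The nonvanishing holds over the reals and is carried to the complex numbers by
    the ring homomorphism \<open>of_real\<close>.\<close>
  have "map_mat complex_of_real
      (indexed_mat vs (\<lambda>u v. (if u = v then of_nat k else 0) - (adj u v - 1)))
    = indexed_mat vs (\<lambda>u v. (if u = v then of_nat k else 0) - (adj u v - 1))"
    by (intro eq_matI) (auto simp: indexed_mat_def adj_def)
  then have "poly ?q (of_nat k) = complex_of_real
      (det (indexed_mat vs (\<lambda>u v. (if u = v then of_nat k else 0) - (adj u v - 1))))"
    by (simp add: poly_char_poly_indexed_mat[OF distinct_vs] flip: of_real_hom.hom_det)
  then have q: "poly ?q (of_nat k) \<noteq> 0"
    using det_minus_ones_nonzero[OF assms] by simp
  then have q0: "?q \<noteq> 0" by auto
  have "order (of_nat k) (?p * [:of_nat (length vs) - of_nat k, 1:])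
    = order (of_nat k) ([:- of_nat k, 1:] * ?q)"
    by (simp only: char_poly_minus_ones)
  moreover have "order (of_nat k) ([:- of_nat k, 1:] * ?q) = 1"
  proof (subst order_mult)
    show "[:- of_nat k, 1:] * ?q \<noteq> 0"
      using q0 by (simp only: mult_eq_0_iff) simp
    show "order (of_nat k) [:- of_nat k, 1:] + order (of_nat k) ?q = 1"
      using order_power_n_n[of "of_nat k :: complex" 1] order_0I[OF q] by simp
  qed
  moreover have "?p \<noteq> 0"
    using degree_monic_char_poly[OF indexed_mat_carrier[of vs "adj :: _ \<Rightarrow> _ \<Rightarrow> complex"]] by auto
  moreover have "order (of_nat k) [:of_nat (length vs) - of_nat k, 1 :: complex:] = 0"
    using assms(1) by (intro order_0I) auto
  moreover have "?p * [:of_nat (length vs) - of_nat k, 1:] \<noteq> 0"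
    using \<open>?p \<noteq> 0\<close> by (simp only: mult_eq_0_iff) simp
  note order_mult[OF this, of "of_nat k"]
  ultimately show ?thesis
    by (simp only: count_proots add_0_right not_False_eq_True)
qed

end

section \<open>From the graph and its walk to the arc matrices\<close>

text \<open>Connectedness is reachability in the symmetric closure, and equality of values passes
  along an arc in either direction.\<close>

lemma connected_locally_constant:
  assumes "Digraph_Component.connected (with_proj G)"
    and "\<And>u v. (u, v) \<in> parcs G \<Longrightarrow> f u = f v"
    and "u \<in> pverts G" "v \<in> pverts G"
  shows "f u = f v"
proof -
  let ?H = "with_proj (mk_symmetric (with_proj G))"
  have "u \<rightarrow>\<^sup>*\<^bsub>?H\<^esub> v"
    using assms(1,3,4) by (auto simp: connected_def strongly_connected_def)
  then have "(u, v) \<in> rtrancl_on (verts ?H) (arcs_ends ?H)"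
    by (simp add: reachable_def)
  then show ?thesis
  proof (induction rule: rtrancl_on_induct)
    case (step y z)
    then show ?case
      using assms(2) by (auto simp: parcs_mk_symmetric)
  qed simp
qed

lemma regular_arcs_of_graph:
  assumes "pair_graph G" "regular_graph G k" "enumerates vs (pverts G)" "enumerates es (parcs G)"
  shows "regular_arcs vs es k"
proof -
  interpret pair_graph G by fact
  show ?thesis
  proof
    show "distinct vs" "distinct es" "set es \<subseteq> set vs \<times> set vs"
      using assms(3,4) by (auto simp: enumerates_def dest: arc_fst_in_verts arc_snd_in_verts)
    show "(v, u) \<in> set es" if "(u, v) \<in> set es" for u v
      using that assms(4) arcs_symmetric by (auto simp: enumerates_def)
    show "card {w. (v, w) \<in> set es} = k" if "v \<in> set vs" for v
    proof -
      have "out_arcs (with_proj G) v = Pair v ` {w. (v, w) \<in> set es}"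
        using assms(4) by (auto simp: out_arcs_def enumerates_def)
      then have "card {w. (v, w) \<in> set es} = out_degree (with_proj G) v"
        by (simp add: out_degree_def card_image inj_on_def)
      then show ?thesis
        using assms(2,3) that by (simp add: regular_graph_def enumerates_def)
    qed
  qed
qed

text \<open>
  For \<open>k \<ge> 3\<close> the only negative entries of \<open>U\<close> are the backtracking ones, so an entry of \<open>U\<^sup>2\<close>
  is positive iff its unique two-step path backtracks twice (the diagonal) or not at all.
\<close>

lemma positive_support_transition_square:
  assumes graph: "pair_graph G" "regular_graph G k" "enumerates vs (pverts G)" "enumerates es (parcs G)"
    and k: "k \<ge> 3"
  shows "positive_support (transition_matrix G es ^\<^sub>m 2) = indexed_mat es
    (\<lambda>e f. of_bool (e = f) + (\<Sum>g\<in>set es.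
      nonbacktracking e g * nonbacktracking g f))"
proof -
  interpret regular_arcs vs es k
    using graph by (rule regular_arcs_of_graph)
  have V: "set vs = pverts G"
    using graph by (simp add: enumerates_def)
  define a where "a = 2 / real k"
  have a: "0 < a" "a < 1"
    using k by (simp_all add: a_def)
  \<comment> \<open>By regularity every entry between consecutive arcs is \<open>a\<close>, lowered
    by 1 for backtracking.\<close>
  have T: "transition_entry G e g = of_bool (snd g = fst e) * (a - of_bool (fst g = snd e))"
    if "g \<in> set es" for e g
  proof (cases e; cases g)
    fix w x u v assume eg: "e = (w, x)" "g = (u, v)"
    then have "out_degree (with_proj G) v = k"
      using that arcs_subset graph(2) V by (auto simp: regular_graph_def)
    then show ?thesis by (auto simp: eg a_def)
  qed
  have square: "(\<Sum>g\<in>set es. transition_entry G e g * transition_entry G g f)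
    = of_bool ((snd f, fst e) \<in> set es) * ((a - of_bool (snd f = snd e)) * (a - of_bool (fst f = fst e)))"
    if "f \<in> set es" for e f
  proof -
    have "(\<Sum>g\<in>set es. transition_entry G e g * transition_entry G g f)
      = (\<Sum>g\<in>set es. if g = (snd f, fst e)
          then (a - of_bool (snd f = snd e)) * (a - of_bool (fst f = fst e)) else 0)"
      by (intro sum.cong) (auto simp: T that)
    then show ?thesis by simp
  qed
  have "transition_matrix G es ^\<^sub>m 2
    = indexed_mat es (\<lambda>e f. \<Sum>g\<in>set es. transition_entry G e g * transition_entry G g f)"
    by (simp add: transition_matrix_def numeral_2_eq_2 indexed_mat_mult[OF distinct_es])
  then have "positive_support (transition_matrix G es ^\<^sub>m 2) = indexed_mat es (\<lambda>e f.
      if (\<Sum>g\<in>set es. transition_entry G e g * transition_entry G g f) > 0 then 1 else 0)"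
    by (simp add: positive_support_def indexed_mat_def map_mat_def) (intro eq_matI; simp)
  also have "\<dots> = indexed_mat es
    (\<lambda>e f. of_bool (e = f) + (\<Sum>g\<in>set es. nonbacktracking e g * nonbacktracking g f))"
  proof (rule indexed_mat_cong)
    fix e f assume ef: "e \<in> set es" "f \<in> set es"
    \<comment> \<open>For \<open>f = e\<close> the middle arc is the reversal of \<open>e\<close>,
      so the walk that backtracks twice exists.\<close>
    have "(snd e, fst e) \<in> set es"
      using ef(1) sym_arcs[of "fst e" "snd e"] by simp
    moreover have "(a - 1) * (a - 1) > 0" "a * (a - 1) \<le> 0" "(a - 1) * a \<le> 0" "a * a > 0"
      using a by (simp_all add: mult_nonneg_nonpos mult_nonpos_nonneg mult_neg_neg)
    ultimately show "(if (\<Sum>g\<in>set es. transition_entry G e g * transition_entry G g f) > 0 then 1 else 0)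
      = of_bool (e = f) + (\<Sum>g\<in>set es. nonbacktracking e g * nonbacktracking g f)"
      unfolding square[OF ef(2)] nonbacktracking_square[OF ef]
      by (auto simp: prod_eq_iff not_less)
  qed
  finally show ?thesis .
qed

theorem theorem4p2:
  fixes G :: "'v pair_pre_digraph" and n k :: nat
    and vs :: "'v list" and es :: "('v \<times> 'v) list"
    and A U :: "real mat"
  assumes "pair_graph G"
    and "Digraph_Component.connected (with_proj G)"
    and "regular_graph G k"
    and "k \<ge> 3"
    and "n = card (pverts G)"
    and "enumerates vs (pverts G)"
    and "enumerates es (parcs G)"
    and "A = adjacency_matrix G vs"
    and "U = transition_matrix G es"
  shows "complex_eigenvalues (positive_support (U ^\<^sub>m 2)) =
      {# (of_nat k)^2 - 2 * of_nat k + 2 #}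
    + (\<Sum>\<^sub># {# {# (l^2 - 2 * of_nat k + 4) / 2 + l * csqrt (l^2 - 4 * (of_nat k - 1)) / 2,
                 (l^2 - 2 * of_nat k + 4) / 2 - l * csqrt (l^2 - 4 * (of_nat k - 1)) / 2 #}.
              l \<in># filter_mset (\<lambda>l. l \<noteq> of_nat k) (complex_eigenvalues A) #})
    + replicate_mset (n * (k - 2) + 1) 2"
proof -
  interpret regular_arcs vs es k
    using assms(1,3,6,7) by (rule regular_arcs_of_graph)
  have V: "set vs = pverts G" and E: "set es = parcs G"
    using assms(6,7) by (simp_all add: enumerates_def)
  have n: "length vs = n"
    using assms(5) V distinct_card[OF distinct_vs] by simp
  have "pverts G \<noteq> {}"
    using assms(2) by (auto simp: connected_def strongly_connected_def)
  then have "vs \<noteq> []"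
    using V by auto
  define M where "M = complex_eigenvalues A"
  have "map_mat complex_of_real A = indexed_mat vs adj"
    by (intro eq_matI) (auto simp: assms(8) adjacency_matrix_def indexed_mat_def adj_def E)
  then have M: "M = proots (char_poly (indexed_mat vs adj))"
    by (simp add: M_def complex_eigenvalues_def)
  have "count M (of_nat k) = 1"
    unfolding M using \<open>vs \<noteq> []\<close> connected_locally_constant[OF assms(2)]
    by (intro count_valency_eigenvalue) (auto simp: V E)
  \<comment> \<open>By simplicity the filter drops exactly one eigenvalue, whose pair is evaluated
    separately.\<close>
  then have M_split: "M = {#of_nat k#} + filter_mset (\<lambda>l. l \<noteq> of_nat k) M"
    by (intro multiset_eqI) auto
  have "map_mat complex_of_real (positive_support (U ^\<^sub>m 2)) = indexed_mat es
      (\<lambda>e f. of_bool (e = f) + (\<Sum>g\<in>set es. nonbacktracking e g * nonbacktracking g f))"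
    unfolding assms(9) positive_support_transition_square[OF assms(1,3,6,7,4)]
    by (intro eq_matI) (auto simp: indexed_mat_def nonbacktracking_def)
  then have "complex_eigenvalues (positive_support (U ^\<^sub>m 2))
    = proots ([:-2, 1:] ^ (n * (k - 2)) * (\<Prod>l\<in>#M. \<Prod>m\<in>#walk_eigenvalues k l. [:- m, 1:]))"
    using assms(4) by (simp add: complex_eigenvalues_def char_poly_nonbacktracking_square_plus_one M n)
  also have "\<dots> = replicate_mset (n * (k - 2)) 2 + (\<Sum>\<^sub># (image_mset (walk_eigenvalues k) M))"
    by (subst proots_mult)
      (auto simp: proots_power proots_prod_walk_eigenvalues repeat_mset_replicate_mset[of _ 1, simplified] prod_mset_zero_iff)
  \<comment> \<open>The pair of \<open>l = k\<close> consists of item (i) and one further 2, which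
    is the \<open>+ 1\<close> in item (iii).\<close>
  also have "(\<Sum>\<^sub># (image_mset (walk_eigenvalues k) M)) = walk_eigenvalues k (of_nat k)
      + \<Sum>\<^sub># (image_mset (walk_eigenvalues k) (filter_mset (\<lambda>l. l \<noteq> of_nat k) M))"
    by (subst M_split) simp
  finally have "complex_eigenvalues (positive_support (U ^\<^sub>m 2)) =
      {# (of_nat k)^2 - 2 * of_nat k + 2 #}
    + (\<Sum>\<^sub># {# walk_eigenvalues k l. l \<in># filter_mset (\<lambda>l. l \<noteq> of_nat k) M #})
    + replicate_mset (n * (k - 2) + 1) 2"
    using assms(4) by (simp add: walk_eigenvalues_valency)
  then show ?thesis
    unfolding walk_eigenvalues_def M_def .
qed

end
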